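(* In the market described in the context: (i) For any functions $h_a$ (with $h_a(\mathcal{B}_{-a})\in\mathbb{R}$ depending only on the bids of areas other than $a$), the Groves payment $p_a(\mathcal{B})=b_a(\chi^*_{E_a}(\mathcal{B}))-(V(\mathcal{B})-h_a(\mathcal{B}_{-a}))$, $a\in A$, yields a dominant-strategy incentive-compatible (DSIC) mechanism: for every area $a$, every admissible profile $\mathcal{B}_{-a}$ of the other areas and every admissible bid $\mathcal{B}_a$, $u_a(\mathcal{V}_a\cup\mathcal{B}_{-a})\ge u_a(\mathcal{B}_a\cup\mathcal{B}_{-a})$. (ii) The VCG mechanism, i.e. the Groves payment with the Clarke pivot rule $h_a(\mathcal{B}_{-a})=V(\mathcal{B}_{-a})$, ensures individual rationality: for every admissible profile $\mathcal{B}$ and every $a\in A$, $\bar u_a(\mathcal{B})=b_a(\chi^*_{E_a}(\mathcal{B}))-p_a(\mathcal{B})\ge0$.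
   Context: Market. $(A,E)$ is a finite connected simple undirected graph; $A$ is the set of areas, $E$ the set of links. For $S\subseteq A$, $E_S$ is the set of links with exactly one endpoint in $S$ (write $E_a=E_{\{a\}}$), and $E^S$ is the set of links with both endpoints in $S$. An allocation is $\chi\in[0,1]^E$; for $F\subseteq E$, $\chi_F=\{\chi_e\}_{e\in F}$. A default allocation $\chi'\in[0,1]^E$ and a set $\mathbb{S}\subseteq[0,1]^E$ with $\chi'\in\mathbb{S}$ are fixed. Each area $a$ has a true valuation $v_a:\mathbb{X}_a\to\mathbb{R}$, where $\chi'_{E_a}\in\mathbb{X}_a\subseteq[0,1]^{E_a}$ and $v_a(\chi'_{E_a})=0$; by convention $v_a=-\infty$ outside $\mathbb{X}_a$. Each area submits a (possibly nontruthful) bid $b_a:\hat{\mathbb{X}}_a\to\mathbb{R}$ with $\chi'_{E_a}\in\hat{\mathbb{X}}_a\subseteq[0,1]^{E_a}$ and $b_a(\chi'_{E_a})=0$. No continuity, convexity, monotonicity or sign conditions are imposed. A bid profile is $\mathcal{B}=\{b_a\}_{a\in A}$, the true profile is $\mathcal{V}=\{v_a\}_{a\in A}$; for $S\subseteq A$, $\mathcal{B}_S=\{b_a\}_{a\in S}$, $\mathcal{B}_a=\{b_a\}$, $\mathcal{V}_a=\{v_a\}$, $\mathcal{B}_{-a}=\{b_j\}_{j\in A\setminus\{a\}}$. Each area has a set of admissible bids containing $v_a$, a profile is admissible if every component is, and all maxima below are assumed attained for admissible profiles. Allocation rule: $\chi^*(\mathcal{B})$ is a maximizer (selected by a fixed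 tie-breaking rule) of $$V(\mathcal{B})=\max_{\chi\in\mathbb{S}}\sum_{a\in A}b_a(\chi_{E_a})\ \text{ s.t. } \chi_{E_a}\in\hat{\mathbb{X}}_a\ \forall a\in A.$$ For $S\subseteq A$, $$V(\mathcal{B}_S)=\max_{\chi\in\mathbb{S}}\sum_{a\in S}b_a(\chi_{E_a})\ \text{ s.t. } \chi_{E_a}\in\hat{\mathbb{X}}_a\ \forall a\in S,\quad \chi_e=\chi'_e\ \forall e\in E\setminus E^S,$$ and $V(\mathcal{B}_{-a})$ is this value for $S=A\setminus\{a\}$. (When an area bids truthfully, its bid is $v_a$ with domain $\mathbb{X}_a$.) A payment rule assigns $p_a(\mathcal{B})\in\mathbb{R}$ to each area. True utilities: $u_a(\mathcal{B})=v_a(\chi^*_{E_a}(\mathcal{B}))-p_a(\mathcal{B})$. Revealed utilities: $\bar u_a(\mathcal{B})=b_a(\chi^*_{E_a}(\mathcal{B}))-p_a(\mathcal{B})$. *)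

theory Defs
  imports Complex_Main "HOL-Library.FuncSet" "HOL-Library.Extended_Real"
begin

text \<open>
  A link is the two-element set of its endpoints. An allocation on a set \<open>F\<close> of links is an
  element of \<open>F \<rightarrow>\<^sub>E {0..1}\<close>; its restriction to \<open>G \<subseteq> F\<close> is \<^const>\<open>restrict\<close>. A bid is a partial
  map on the allocations of the links of one area, whose \<^const>\<open>dom\<close> is the domain of the bid.
  A bid profile of the areas in \<open>S\<close> is a function that is extensional on \<open>S\<close>.
\<close>

type_synonym 'a alloc = "'a set \<Rightarrow> real"
type_synonym 'a bid = "'a alloc \<rightharpoonup> real"
type_synonym 'a profile = "'a \<Rightarrow> 'a bid"

record 'a market =
  areas :: "'a set"
  links :: "'a set set"
  allocs :: "'a alloc set"
  default_alloc :: "'a alloc"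
  valuation :: "'a profile"
  admissible :: "'a \<Rightarrow> 'a bid set"

definition connected_simple_graph :: "'a set \<Rightarrow> 'a set set \<Rightarrow> bool" where
  "connected_simple_graph A E \<longleftrightarrow>
     A \<noteq> {} \<and> (\<forall>e\<in>E. e \<subseteq> A \<and> card e = 2) \<and>
     (\<forall>a\<in>A. \<forall>b\<in>A. (a, b) \<in> {(x, y). {x, y} \<in> E}\<^sup>*)"

definition cut :: "'a market \<Rightarrow> 'a set \<Rightarrow> 'a set set" where
  "cut M S = {e \<in> links M. card (e \<inter> S) = 1}"

definition inner_links :: "'a market \<Rightarrow> 'a set \<Rightarrow> 'a set set" where
  "inner_links M S = {e \<in> links M. e \<subseteq> S}"

definition local_alloc :: "'a market \<Rightarrow> 'a \<Rightarrow> 'a alloc \<Rightarrow> 'a alloc" where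
  "local_alloc M a \<chi> = restrict \<chi> (cut M {a})"

definition is_bid :: "'a market \<Rightarrow> 'a \<Rightarrow> 'a bid \<Rightarrow> bool" where
  "is_bid M a b \<longleftrightarrow>
     dom b \<subseteq> (cut M {a} \<rightarrow>\<^sub>E {0..1}) \<and> b (local_alloc M a (default_alloc M)) = Some 0"

definition profiles :: "'a market \<Rightarrow> 'a set \<Rightarrow> 'a profile set" where
  "profiles M S = (\<Pi>\<^sub>E a\<in>S. admissible M a)"

definition feasible :: "'a market \<Rightarrow> 'a set \<Rightarrow> 'a profile \<Rightarrow> 'a alloc \<Rightarrow> bool" where
  "feasible M S B \<chi> \<longleftrightarrow>
     \<chi> \<in> allocs M \<and> (\<forall>a\<in>S. local_alloc M a \<chi> \<in> dom (B a)) \<and>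
     (\<forall>e \<in> links M - inner_links M S. \<chi> e = default_alloc M e)"

text \<open>For feasible \<open>\<chi>\<close> every \<^const>\<open>the\<close> below is applied to a defined value.\<close>

definition welfare :: "'a market \<Rightarrow> 'a set \<Rightarrow> 'a profile \<Rightarrow> 'a alloc \<Rightarrow> real" where
  "welfare M S B \<chi> = (\<Sum>a\<in>S. the (B a (local_alloc M a \<chi>)))"

text \<open>
  \<open>max_welfare M S B\<close> is $V(\mathcal{B}_S)$; for \<open>S = areas M\<close> no link is fixed to its default
  (see \<open>feasible_areas\<close> below), so this is $V(\mathcal{B})$.
\<close>

definition max_welfare :: "'a market \<Rightarrow> 'a set \<Rightarrow> 'a profile \<Rightarrow> real" where
  "max_welfare M S B = (GREATEST w. w \<in> welfare M S B ` {\<chi>. feasible M S B \<chi>})"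

locale market =
  fixes M :: "'a market"
  assumes finite_areas: "finite (areas M)"
    and graph: "connected_simple_graph (areas M) (links M)"
    and allocs: "allocs M \<subseteq> (links M \<rightarrow>\<^sub>E {0..1})"
    and default_alloc: "default_alloc M \<in> allocs M"
    and valuation_admissible: "a \<in> areas M \<Longrightarrow> valuation M a \<in> admissible M a"
    and admissible_bids: "a \<in> areas M \<Longrightarrow> b \<in> admissible M a \<Longrightarrow> is_bid M a b"
    and max_attained: "B \<in> profiles M (areas M) \<Longrightarrow> S \<subseteq> areas M \<Longrightarrow>
           \<exists>\<chi>. is_arg_max (welfare M S B) (feasible M S B) \<chi>"

lemma (in market) feasible_areas:
  "feasible M (areas M) B \<chi> \<longleftrightarrow>
     \<chi> \<in> allocs M \<and> (\<forall>a\<in>areas M. local_alloc M a \<chi> \<in> dom (B a))"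
  using graph by (auto simp: feasible_def inner_links_def connected_simple_graph_def)

text \<open>
  The tie-breaking rule is an arbitrary choice of a maximizer for every admissible profile.
\<close>

definition allocation_rule :: "'a market \<Rightarrow> ('a profile \<Rightarrow> 'a alloc) \<Rightarrow> bool" where
  "allocation_rule M x \<longleftrightarrow>
     (\<forall>B \<in> profiles M (areas M).
        is_arg_max (welfare M (areas M) B) (feasible M (areas M) B) (x B))"

definition extended_value :: "'a bid \<Rightarrow> 'a alloc \<Rightarrow> ereal" where
  "extended_value b \<chi> = (case b \<chi> of None \<Rightarrow> -\<infinity> | Some r \<Rightarrow> ereal r)"

type_synonym 'a payment = "'a \<Rightarrow> 'a profile \<Rightarrow> real"

text \<open>
  True utilities are extended reals because a nontruthful bid of \<open>a\<close> may lead to an allocation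
  outside the domain of its valuation.
\<close>

definition true_utility ::
    "'a market \<Rightarrow> ('a profile \<Rightarrow> 'a alloc) \<Rightarrow> 'a payment \<Rightarrow> 'a \<Rightarrow> 'a profile \<Rightarrow> ereal" where
  "true_utility M x p a B =
     extended_value (valuation M a) (local_alloc M a (x B)) - ereal (p a B)"

definition revealed_utility ::
    "'a market \<Rightarrow> ('a profile \<Rightarrow> 'a alloc) \<Rightarrow> 'a payment \<Rightarrow> 'a \<Rightarrow> 'a profile \<Rightarrow> real" where
  "revealed_utility M x p a B = the (B a (local_alloc M a (x B))) - p a B"

definition groves_payment ::
    "'a market \<Rightarrow> ('a profile \<Rightarrow> 'a alloc) \<Rightarrow> ('a \<Rightarrow> 'a profile \<Rightarrow> real) \<Rightarrow> 'a payment" where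
  "groves_payment M x h a B =
     the (B a (local_alloc M a (x B)))
       - (max_welfare M (areas M) B - h a (restrict B (areas M - {a})))"

definition clarke_pivot :: "'a market \<Rightarrow> 'a \<Rightarrow> 'a profile \<Rightarrow> real" where
  "clarke_pivot M a B = max_welfare M (areas M - {a}) B"

definition vcg_payment :: "'a market \<Rightarrow> ('a profile \<Rightarrow> 'a alloc) \<Rightarrow> 'a payment" where
  "vcg_payment M x = groves_payment M x (clarke_pivot M)"

definition dsic :: "'a market \<Rightarrow> ('a profile \<Rightarrow> 'a alloc) \<Rightarrow> 'a payment \<Rightarrow> bool" where
  "dsic M x p \<longleftrightarrow>
     (\<forall>a \<in> areas M. \<forall>B \<in> profiles M (areas M - {a}). \<forall>b \<in> admissible M a.
        true_utility M x p a (B(a := valuation M a)) \<ge> true_utility M x p a (B(a := b)))"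

definition individually_rational ::
    "'a market \<Rightarrow> ('a profile \<Rightarrow> 'a alloc) \<Rightarrow> 'a payment \<Rightarrow> bool" where
  "individually_rational M x p \<longleftrightarrow>
     (\<forall>B \<in> profiles M (areas M). \<forall>a \<in> areas M. revealed_utility M x p a B \<ge> 0)"

end

theory Submission
  imports Defs
begin

text \<open>
  Under a Groves payment the true utility of \<open>a\<close> is, up to a term that its own bid cannot
  influence, the welfare of the chosen allocation with respect to the profile in which \<open>a\<close> is
  truthful; a truthful bid makes the mechanism maximize exactly this quantity. Under the Clarke
  pivot rule the revealed utility of \<open>a\<close> is $V(\mathcal{B}) - V(\mathcal{B}_{-a})$, and any
  allocation feasible without \<open>a\<close> leaves the links of \<open>a\<close> at their default, so it remains
  feasible with \<open>a\<close> at the same welfare.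
\<close>

text \<open>\<open>GREATEST\<close> denotes the optimum only if one exists; a maximizer is the
  witness that pins it down.\<close>

lemma max_welfare_eq:
  assumes "is_arg_max (welfare M S B) (feasible M S B) \<chi>"
  shows "max_welfare M S B = welfare M S B \<chi>"
  unfolding max_welfare_def
  by (rule Greatest_equality) (use assms in \<open>auto simp: is_arg_max_def not_less\<close>)

lemma allocation_rule_feasible:
  assumes "allocation_rule M x" "B \<in> profiles M (areas M)"
  shows "feasible M (areas M) B (x B)"
  using assms by (auto simp: allocation_rule_def is_arg_max_def)

lemma allocation_rule_max_welfare:
  assumes "allocation_rule M x" "B \<in> profiles M (areas M)"
  shows "max_welfare M (areas M) B = welfare M (areas M) B (x B)"
  using assms by (auto simp: allocation_rule_def intro: max_welfare_eq)

lemma welfare_le_allocation_rule: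
  assumes "allocation_rule M x" "B \<in> profiles M (areas M)" "feasible M (areas M) B \<chi>"
  shows "welfare M (areas M) B \<chi> \<le> welfare M (areas M) B (x B)"
  using assms by (auto simp: allocation_rule_def is_arg_max_def not_less)

lemma feasible_cong:
  "(\<And>a. a \<in> S \<Longrightarrow> B a = B' a) \<Longrightarrow> feasible M S B = feasible M S B'"
  by (auto simp: feasible_def fun_eq_iff)

lemma welfare_cong:
  "(\<And>a. a \<in> S \<Longrightarrow> B a = B' a) \<Longrightarrow> welfare M S B = welfare M S B'"
  by (auto simp: welfare_def fun_eq_iff)

lemma max_welfare_cong:
  "(\<And>a. a \<in> S \<Longrightarrow> B a = B' a) \<Longrightarrow> max_welfare M S B = max_welfare M S B'"
  unfolding max_welfare_def
  using feasible_cong[of S B B' M] welfare_cong[of S B B' M] by simp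

lemma profiles_fun_upd:
  assumes "B \<in> profiles M (S - {a})" "b \<in> admissible M a" "a \<in> S"
  shows "B(a := b) \<in> profiles M S"
  using assms by (auto simp: profiles_def PiE_iff extensional_def)

context market
begin

lemma welfare_remove:
  assumes "a \<in> areas M"
  shows "welfare M (areas M) B \<chi> =
    the (B a (local_alloc M a \<chi>)) + welfare M (areas M - {a}) B \<chi>"
  unfolding welfare_def using finite_areas assms by (rule sum.remove)

text \<open>A link in \<open>cut M {a}\<close> has \<open>a\<close> as an endpoint, so it is not an
  inner link of the other areas and feasibility fixes it.\<close>

lemma local_alloc_eq_default:
  assumes "feasible M (areas M - {a}) B \<chi>"
  shows "local_alloc M a \<chi> = local_alloc M a (default_alloc M)"
proof -
  have "cut M {a} \<subseteq> links M - inner_links M (areas M - {a})"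
    by (auto simp: cut_def inner_links_def card_1_singleton_iff)
  then show ?thesis
    using assms by (auto simp: feasible_def local_alloc_def restrict_def fun_eq_iff)
qed

text \<open>In the payment the reported value of \<open>a\<close> cancels against its summand in
  \<open>max_welfare\<close>, leaving the \<open>h\<close> term minus the welfare of the others. The
  domain assumption makes the true value finite.\<close>

lemma true_utility_groves:
  assumes "allocation_rule M x" "B \<in> profiles M (areas M)" "a \<in> areas M"
    and "local_alloc M a (x B) \<in> dom (valuation M a)"
  shows "true_utility M x (groves_payment M x h) a B =
    ereal (welfare M (areas M) (B(a := valuation M a)) (x B)
           - h a (restrict B (areas M - {a})))"
proof -
  have "welfare M (areas M - {a}) (B(a := valuation M a)) = welfare M (areas M - {a}) B"
    by (rule welfare_cong) simp
  then show ?thesis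
    using assms allocation_rule_max_welfare[OF assms(1,2)]
    by (auto simp: true_utility_def groves_payment_def extended_value_def welfare_remove[OF assms(3)])
qed

lemma groves_dsic:
  assumes "allocation_rule M x"
  shows "dsic M x (groves_payment M x h)"
  unfolding dsic_def
proof (intro ballI)
  fix a B b
  assume a: "a \<in> areas M" and B: "B \<in> profiles M (areas M - {a})" and b: "b \<in> admissible M a"
  let ?T = "B(a := valuation M a)" and ?L = "B(a := b)"
  have T: "?T \<in> profiles M (areas M)" and L: "?L \<in> profiles M (areas M)"
    using profiles_fun_upd B a b valuation_admissible by metis+
  \<comment> \<open>Hence the \<open>h\<close> term is the same number in both utilities.\<close>
  have restr: "restrict ?T (areas M - {a}) = restrict ?L (areas M - {a})"
    by (auto simp: restrict_def)
  have domT: "local_alloc M a (x ?T) \<in> dom (valuation M a)"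
    using allocation_rule_feasible[OF assms T] a by (auto simp: feasible_def)
  show "true_utility M x (groves_payment M x h) a ?L \<le> true_utility M x (groves_payment M x h) a ?T"
  \<comment> \<open>A false bid may lead outside the domain of the valuation; the true utility is
    then -\<infinity>.\<close>
  proof (cases "local_alloc M a (x ?L) \<in> dom (valuation M a)")
    case True
    then have "feasible M (areas M) ?T (x ?L)"
      using allocation_rule_feasible[OF assms L] by (auto simp: feasible_areas split: if_splits)
    from welfare_le_allocation_rule[OF assms T this] show ?thesis
      \<comment> \<open>Overwriting the bid of \<open>a\<close> turns both profiles into
        \<open>?T\<close>, so two allocations are compared under one welfare function.\<close>
      unfolding true_utility_groves[OF assms L a True, unfolded fun_upd_upd]
        true_utility_groves[OF assms T a domT, unfolded fun_upd_upd] restr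
      by simp
  next
    case False
    then show ?thesis
      by (auto simp: true_utility_def extended_value_def split: option.splits)
  qed
qed

lemma max_welfare_remove_le:
  assumes "allocation_rule M x" "B \<in> profiles M (areas M)" "a \<in> areas M"
  shows "max_welfare M (areas M - {a}) B \<le> max_welfare M (areas M) B"
proof -
  obtain \<chi> where \<chi>: "is_arg_max (welfare M (areas M - {a}) B) (feasible M (areas M - {a}) B) \<chi>"
    using max_attained[OF assms(2), of "areas M - {a}"] by blast
  then have feas: "feasible M (areas M - {a}) B \<chi>"
    by (simp add: is_arg_max_def)
  have "B a \<in> admissible M a"
    using assms(2,3) by (auto simp: profiles_def)
  \<comment> \<open>The normalization of bids serves twice: \<chi> satisfies the domain condition of
    \<open>a\<close>, and \<open>a\<close> adds 0 to the welfare.\<close>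
  then have zero: "B a (local_alloc M a \<chi>) = Some 0"
    using admissible_bids[OF assms(3)] local_alloc_eq_default[OF feas] by (simp add: is_bid_def)
  with feas have "feasible M (areas M) B \<chi>"
    by (auto simp: feasible_areas) (auto simp: feasible_def)
  from welfare_le_allocation_rule[OF assms(1,2) this] show ?thesis
    using zero max_welfare_eq[OF \<chi>] allocation_rule_max_welfare[OF assms(1,2)]
      welfare_remove[OF assms(3), of B \<chi>]
    by simp
qed

lemma vcg_individually_rational:
  assumes "allocation_rule M x"
  shows "individually_rational M x (vcg_payment M x)"
  unfolding individually_rational_def
proof (intro ballI)
  fix B a
  assume B: "B \<in> profiles M (areas M)" and a: "a \<in> areas M"
  \<comment> \<open>The maximum over the other areas never reads the bid that
    \<open>restrict\<close> erases.\<close>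
  have "clarke_pivot M a (restrict B (areas M - {a})) = max_welfare M (areas M - {a}) B"
    unfolding clarke_pivot_def by (rule max_welfare_cong) simp
  then show "0 \<le> revealed_utility M x (vcg_payment M x) a B"
    using max_welfare_remove_le[OF assms B a]
    by (simp add: revealed_utility_def vcg_payment_def groves_payment_def)
qed

end

theorem proposition1:
  fixes M :: "'a market" and x :: "'a profile \<Rightarrow> 'a alloc"
  assumes "market M" and "allocation_rule M x"
  shows "(\<forall>h :: 'a \<Rightarrow> 'a profile \<Rightarrow> real. dsic M x (groves_payment M x h)) \<and>
         individually_rational M x (vcg_payment M x)"
  using market.groves_dsic[OF assms] market.vcg_individually_rational[OF assms] by blast

end
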